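(* Let $n>1$, $\mathbf{k}=(k_1,\dots,k_n)\in\mathbb{Z}_{>0}^n$, and let $P=\bigoplus_{j=1}^n P_j(u_j)$, $P_j(u_j)=\min_{0\le i\le k_j}\{a_{i,j}+u_j^{(i)}\}$ with $a_{i,j}\in\mathbb{Z}$, be a tropical linear differential equation in $n$ unknowns. Write $A_j=\min_{0\le i\le k_j}\{a_{i,j}+k_j-i\}$ and let $L(P)\subseteq[n]$ be the set of $j$ for which this minimum is attained for at least two values of $i$. (i) $$\mathcal{C}_{\mathbb{Z}_{\ge0}}(P)=\bigcup_{j\in L(P)}\{t_j^{k_j+r}: r\in\mathbb{Z}_{\ge0}\}\ \cup\bigcup_{\substack{a,b\notin L(P),\ a\ne b\\ A_b\le A_a}}\{t_a^{k_a+r}+t_b^{k_b+A_a-A_b+r}: r\in\mathbb{Z}_{\ge0}\}.$$ (ii) The set $F(P)=\mu(\mathrm{Sol}(P))\setminus\mathcal{C}_{\mathbb{Z}_{\ge0}}(P)$ is finite. Furthermore, if $S\in F(P)$, then either (1) $\mathrm{Supp}(S)=\{j\}$ for some $j$, which holds if and only if $S\in F(P_j)$ (regarding solutions of $P_j$ as tuples concentrated in coordinate $j$); or (2) $\mathrm{Supp}(S)=\{i,j\}$ with $i\ne j$, and $S=t_i^p+t_j^q$ satisfies one of the following: (a) $p<k_i$ and $q<k_j$; (b) $p<k_i$, $j\notin L(P)$, $q\ge k_j$, and $q=q(p)$ is unique (given $i,j,p$ there is only one $q\ge k_j$ with $t_i^p+t_j^q\in F(P)$); or symmetrically $q<k_j$,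 $i\notin L(P)$, $p\ge k_i$, and $p=p(q)$ is unique.
   Context: For $S\subseteq\mathbb{Z}_{\ge0}$, $\mathrm{val}_S(i)=\min\{s-i: s\in S,\ s\ge i\}$, and $\infty$ if no such $s$ exists. A tuple $S=(S_1,\dots,S_n)$ of subsets of $\mathbb{Z}_{\ge0}$ is a solution of $P$ if $\min_{j,\,0\le i\le k_j}\{a_{i,j}+\mathrm{val}_{S_j}(i)\}$ is $\infty$ (only for $S=(\emptyset,\dots,\emptyset)$) or is attained for at least two index pairs $(i,j)$. $\mathrm{Sol}(P)$ is the set of solutions; $\mu(\mathrm{Sol}(P))$ is the set of nonzero (i.e. $\neq(\emptyset,\dots,\emptyset)$) solutions that are minimal, for componentwise inclusion, among nonzero solutions. The tuple with coordinate $j$ equal to $\{p\}$ and all others empty is written $t_j^p$; $t_i^p+t_j^q$ denotes the componentwise union of $t_i^p$ and $t_j^q$. Every element of $\mu(\mathrm{Sol}(P))$ has the form $S=t_i^p+t_j^q$ ($i,j$ not necessarily distinct, $p,q$ not necessarily distinct), and $\mathrm{Supp}(S)=\{i,j\}$ is the set of indices of its nonempty coordinates. $\mathcal{C}_{\mathbb{Z}_{\ge0}}(P)$ is the set of $S\in\mu(\mathrm{Sol}(P))$ with $\mathrm{ord}(S_i)\ge k_i$ for all $i$, where $\mathrm{ord}(T)=\min T$ and $\mathrm{ord}(\emptyset)=\infty$. For the one-unknown equation $P_j$, $\mu(\mathrm{Sol}(P_j))$ is defined analogously (nonempty minimal solutions $T\subseteq\mathbb{Z}_{\ge 0}$) and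 $F(P_j)$ is the set of its elements with $\min T<k_j$. *)

theory Defs
  imports "HOL-Library.Extended_Real" "HOL-Library.Cardinality"
begin

text \<open>
  The unknowns are indexed by a finite type 'n, so the number of unknowns is CARD('n). An equation
  in these unknowns is given by its orders k and its coefficients a, where a i j is the
  coefficient of the i-th derivative of the unknown j. Only the coefficients with i \<le> k j are
  ever used.
\<close>

definition trop_val :: "nat set \<Rightarrow> nat \<Rightarrow> enat" where
  "trop_val S i = (INF s\<in>{s \<in> S. i \<le> s}. enat (s - i))"

definition trop_ord :: "nat set \<Rightarrow> enat" where
  "trop_ord T = (INF s\<in>T. enat s)"

text \<open>The extended reals serve as an ambient ordered structure for the integers with \<open>\<infinity>\<close>.\<close>

definition trop_term :: "int \<Rightarrow> nat set \<Rightarrow> nat \<Rightarrow> ereal" where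
  "trop_term c S i = ereal (of_int c) + ereal_of_enat (trop_val S i)"

text \<open>The following notions are used only for finite nonempty index sets.\<close>

definition attained_twice :: "'i set \<Rightarrow> ('i \<Rightarrow> 'v::linorder) \<Rightarrow> bool" where
  "attained_twice I f \<longleftrightarrow> 2 \<le> card {x \<in> I. f x = Min (f ` I)}"

definition trop_vanishes :: "'i set \<Rightarrow> ('i \<Rightarrow> ereal) \<Rightarrow> bool" where
  "trop_vanishes I f \<longleftrightarrow> Min (f ` I) = \<infinity> \<or> attained_twice I f"

definition Sol :: "('n::finite \<Rightarrow> nat) \<Rightarrow> (nat \<Rightarrow> 'n \<Rightarrow> int) \<Rightarrow> ('n \<Rightarrow> nat set) set" where
  "Sol k a = {S. trop_vanishes {(i, j). i \<le> k j} (\<lambda>(i, j). trop_term (a i j) (S j) i)}"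

definition Sol1 :: "nat \<Rightarrow> (nat \<Rightarrow> int) \<Rightarrow> nat set set" where
  "Sol1 m c = {T. trop_vanishes {..m} (\<lambda>i. trop_term (c i) T i)}"

text \<open>
  Applied both to sets of natural numbers (with inclusion) and to tuples of such sets (with
  componentwise inclusion, the order on functions).
\<close>

definition mu :: "'a::order_bot set \<Rightarrow> 'a set" where
  "mu X = {S \<in> X. S \<noteq> bot \<and> (\<forall>S'\<in>X. S' \<noteq> bot \<longrightarrow> S' \<le> S \<longrightarrow> S' = S)}"

definition Supp :: "('n \<Rightarrow> nat set) \<Rightarrow> 'n set" where
  "Supp S = {j. S j \<noteq> {}}"

definition concentrated :: "'n \<Rightarrow> nat set \<Rightarrow> 'n \<Rightarrow> nat set" where
  "concentrated j T = (\<lambda>_. {})(j := T)"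

definition mono_t :: "'n \<Rightarrow> nat \<Rightarrow> 'n \<Rightarrow> nat set" where
  "mono_t j p = concentrated j {p}"

definition tuple_sum :: "('n \<Rightarrow> nat set) \<Rightarrow> ('n \<Rightarrow> nat set) \<Rightarrow> 'n \<Rightarrow> nat set"
  (infixl "\<oplus>" 65) where
  "S \<oplus> S' = (\<lambda>j. S j \<union> S' j)"

definition CZ :: "('n::finite \<Rightarrow> nat) \<Rightarrow> (nat \<Rightarrow> 'n \<Rightarrow> int) \<Rightarrow> ('n \<Rightarrow> nat set) set" where
  "CZ k a = {S \<in> mu (Sol k a). \<forall>i. enat (k i) \<le> trop_ord (S i)}"

definition FP :: "('n::finite \<Rightarrow> nat) \<Rightarrow> (nat \<Rightarrow> 'n \<Rightarrow> int) \<Rightarrow> ('n \<Rightarrow> nat set) set" where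
  "FP k a = mu (Sol k a) - CZ k a"

definition FP1 :: "nat \<Rightarrow> (nat \<Rightarrow> int) \<Rightarrow> nat set set" where
  "FP1 m c = {T \<in> mu (Sol1 m c). trop_ord T < enat m}"

definition Amin :: "('n \<Rightarrow> nat) \<Rightarrow> (nat \<Rightarrow> 'n \<Rightarrow> int) \<Rightarrow> 'n \<Rightarrow> int" where
  "Amin k a j = Min ((\<lambda>i. a i j + int (k j) - int i) ` {..k j})"

definition LP :: "('n \<Rightarrow> nat) \<Rightarrow> (nat \<Rightarrow> 'n \<Rightarrow> int) \<Rightarrow> 'n set" where
  "LP k a = {j. attained_twice {..k j} (\<lambda>i. a i j + int (k j) - int i)}"

end

theory Submission
  imports Defs
begin

text \<open>
  Call \<open>a i j + s - i\<close> the cost of the element \<open>s \<in> S j\<close> at the index \<open>(i, j)\<close>, where \<open>i \<le> k j\<close>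
  and \<open>i \<le> s\<close>. A nonzero tuple is a solution if and only if the least of all its costs occurs at
  two different indices (lemmas \<open>Sol_E\<close> and \<open>least_at_imp_Sol\<close>). The two elements that
  realise these two occurrences already form a solution, because passing to a smaller tuple
  only removes costs. Hence a minimal solution is a sum of two tuples \<open>t_j^s\<close>, and the two
  elements satisfy one linear equation between their costs (lemma \<open>mu_Sol_E\<close>). This equation
  alone gives finiteness of \<open>FP\<close>: one of the two elements lies below the order of its
  coordinate, so it takes finitely many values, and it determines the other element up to the
  choice of two indices.

  For distinct coordinates more is true: \<open>t_i^p + t_j^q\<close> is a minimal solution if and only if
  neither summand is a solution and both summands have the same least cost (lemma
  \<open>pair_in_mu_Sol_iff\<close>). For \<open>s \<ge> k j\<close>, all indices of the coordinate \<open>j\<close> compete, so the least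
  cost is \<open>Amin k a j + s - k j\<close>, and \<open>t_j^s\<close> is a solution exactly if \<open>j\<close> belongs to \<open>LP k a\<close>.
  These facts describe the set \<open>CZ\<close>, since there two distinct elements cannot share a coordinate;
  and since \<open>Amin k a j + s - k j\<close> is injective in \<open>s\<close>, they show
  that an element \<open>q \<ge> k j\<close> is determined by its partner. The statement on singleton supports
  holds because a tuple concentrated in coordinate \<open>j\<close> has only infinite terms at the other
  coordinates.
\<close>

section \<open>Minima attained twice\<close>

lemma attained_twiceE:
  assumes "attained_twice I f" "finite I"
  obtains x y where "x \<in> I" "y \<in> I" "x \<noteq> y" "f x = f y" "\<forall>z\<in>I. f x \<le> f z"
proof -
  let ?M = "{x \<in> I. f x = Min (f ` I)}"
  have fin: "finite ?M" using assms(2) by simp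
  have "\<not> card ?M \<le> Suc 0" using assms(1) by (simp add: attained_twice_def)
  then obtain x y where "x \<in> ?M" "y \<in> ?M" "x \<noteq> y"
    using card_le_Suc0_iff_eq[OF fin] by blast
  then show thesis using that[of x y] assms(2) by simp
qed

lemma attained_twiceI:
  assumes "finite I" "x \<in> I" "y \<in> I" "x \<noteq> y" "f x = f y" "\<And>z. z \<in> I \<Longrightarrow> f x \<le> f z"
  shows "attained_twice I f"
proof -
  have "Min (f ` I) = f x" using assms by (intro Min_eqI) auto
  then have "{x, y} \<subseteq> {x \<in> I. f x = Min (f ` I)}" using assms by simp
  then have "card {x, y} \<le> card {x \<in> I. f x = Min (f ` I)}"
    using assms(1) by (intro card_mono) simp
  then show ?thesis using assms(4) by (simp add: attained_twice_def)
qed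

lemma trop_vanishesE:
  assumes "trop_vanishes I f" "finite I"
  obtains (infinite) "\<forall>z\<in>I. f z = \<infinity>"
  | (twice) x y where "x \<in> I" "y \<in> I" "x \<noteq> y" "f x = f y" "\<forall>z\<in>I. f x \<le> f z"
proof (cases "attained_twice I f")
  case True
  then show thesis using assms(2) twice by (rule attained_twiceE)
next
  case False
  then have "Min (f ` I) = \<infinity>" using assms(1) by (simp add: trop_vanishes_def)
  then have "\<infinity> \<le> f z" if "z \<in> I" for z
    using Min_le[of "f ` I" "f z"] assms(2) that by simp
  then show thesis using infinite by simp
qed

lemma trop_vanishes_infiniteI:
  assumes "I \<noteq> {}" "\<And>z. z \<in> I \<Longrightarrow> f z = \<infinity>"
  shows "trop_vanishes I f"
proof -
  have "f ` I = {\<infinity>}" using assms by auto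
  then show ?thesis by (simp add: trop_vanishes_def)
qed

lemma trop_vanishes_twiceI:
  assumes "finite I" "x \<in> I" "y \<in> I" "x \<noteq> y" "f x = f y" "\<And>z. z \<in> I \<Longrightarrow> f x \<le> f z"
  shows "trop_vanishes I f"
  using attained_twiceI[OF assms] by (simp add: trop_vanishes_def)

lemma trop_vanishes_subset_iff:
  assumes "finite I" "J \<subseteq> I" "J \<noteq> {}" and inf: "\<And>z. z \<in> I \<Longrightarrow> z \<notin> J \<Longrightarrow> f z = \<infinity>"
  shows "trop_vanishes I f \<longleftrightarrow> trop_vanishes J f"
proof
  assume "trop_vanishes I f"
  then show "trop_vanishes J f" using assms(1)
  proof (cases rule: trop_vanishesE)
    case infinite
    then show ?thesis using assms(2) by (intro trop_vanishes_infiniteI[OF assms(3)]) blast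
  next
    case (twice x y)
    show ?thesis
    proof (cases "f x = \<infinity>")
      case True
      then have "f z = \<infinity>" if "z \<in> J" for z using twice(5) assms(2) that by auto
      then show ?thesis by (rule trop_vanishes_infiniteI[OF assms(3)])
    next
      case False
      then have "x \<in> J" "y \<in> J" using inf[OF twice(1)] inf[OF twice(2)] twice(4) by auto
      then show ?thesis using twice(3-5) assms(2)
        by (intro trop_vanishes_twiceI[OF finite_subset[OF assms(2,1)], of x y]) auto
    qed
  qed
next
  assume "trop_vanishes J f"
  then show "trop_vanishes I f" using finite_subset[OF assms(2,1)]
  proof (cases rule: trop_vanishesE)
    case infinite
    then have "f z = \<infinity>" if "z \<in> I" for z using inf that by blast
    then show ?thesis using assms(2,3) by (intro trop_vanishes_infiniteI) auto
  next
    case (twice x y)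
    have "f x \<le> f z" if "z \<in> I" for z
      using twice(5) inf[OF that] by (cases "z \<in> J") simp_all
    then show ?thesis using twice(1-4) assms(2)
      by (intro trop_vanishes_twiceI[OF assms(1), of x y]) auto
  qed
qed

lemma trop_vanishes_reindex:
  assumes "inj_on h A"
  shows "trop_vanishes (h ` A) f \<longleftrightarrow> trop_vanishes A (\<lambda>x. f (h x))"
proof -
  have "{y \<in> h ` A. f y = m} = h ` {x \<in> A. f (h x) = m}" for m by blast
  then have "card {y \<in> h ` A. f y = m} = card {x \<in> A. f (h x) = m}" for m
    using assms by (simp add: card_image inj_on_subset)
  then show ?thesis by (simp add: trop_vanishes_def attained_twice_def image_image)
qed

section \<open>Solutions in terms of costs\<close>

text \<open>
  The cost of using \<open>s\<close> at the index \<open>(i, j)\<close>; it is meaningful only for \<open>i \<le> s\<close>.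
\<close>

definition cost :: "(nat \<Rightarrow> 'n \<Rightarrow> int) \<Rightarrow> nat \<Rightarrow> 'n \<Rightarrow> nat \<Rightarrow> int" where
  "cost a i j s = a i j + int s - int i"

text \<open>The element \<open>s\<close> of \<open>S j\<close> contributes a finite cost at the index \<open>(i, j)\<close>.\<close>

definition active :: "('n \<Rightarrow> nat) \<Rightarrow> ('n \<Rightarrow> nat set) \<Rightarrow> nat \<Rightarrow> 'n \<Rightarrow> nat \<Rightarrow> bool" where
  "active k S i j s \<longleftrightarrow> s \<in> S j \<and> i \<le> k j \<and> i \<le> s"

text \<open>
  The least cost of \<open>S\<close> is realised by the element \<open>s\<close> at \<open>(i, j)\<close> and by \<open>s'\<close> at \<open>(i', j')\<close>. The
  two indices may coincide here; a solution requires them to differ.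
\<close>

definition least_at :: "('n \<Rightarrow> nat) \<Rightarrow> (nat \<Rightarrow> 'n \<Rightarrow> int) \<Rightarrow> ('n \<Rightarrow> nat set) \<Rightarrow>
    nat \<Rightarrow> 'n \<Rightarrow> nat \<Rightarrow> nat \<Rightarrow> 'n \<Rightarrow> nat \<Rightarrow> bool" where
  "least_at k a S i j s i' j' s' \<longleftrightarrow>
     active k S i j s \<and> active k S i' j' s' \<and> cost a i j s = cost a i' j' s' \<and>
     (\<forall>i'' j'' s''. active k S i'' j'' s'' \<longrightarrow> cost a i j s \<le> cost a i'' j'' s'')"

lemma least_at_le:
  "least_at k a S i j s i' j' s' \<Longrightarrow> active k S i'' j'' s'' \<Longrightarrow> cost a i j s \<le> cost a i'' j'' s''"
  unfolding least_at_def by blast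

lemma trop_term_le:
  assumes "s \<in> S j" "i \<le> s"
  shows "trop_term (a i j) (S j) i \<le> ereal (of_int (cost a i j s))"
proof -
  have "trop_val (S j) i \<le> enat (s - i)"
    unfolding trop_val_def using assms by (intro INF_lower) auto
  then have "ereal_of_enat (trop_val (S j) i) \<le> ereal_of_enat (enat (s - i))"
    by (simp only: ereal_of_enat_le_iff)
  then have "trop_term (a i j) (S j) i \<le> ereal (of_int (a i j)) + ereal_of_enat (enat (s - i))"
    unfolding trop_term_def by (intro add_left_mono)
  also have "\<dots> = ereal (of_int (cost a i j s))"
    using assms(2) by (simp add: cost_def of_nat_diff)
  finally show ?thesis .
qed

text \<open>The infimum in a finite term is attained by an element.\<close>

lemma trop_term_cases:
  obtains (infinite) "\<forall>s\<in>S j. \<not> i \<le> s" "trop_term (a i j) (S j) i = \<infinity>"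
  | (finite) s where "s \<in> S j" "i \<le> s" "trop_term (a i j) (S j) i = ereal (of_int (cost a i j s))"
proof (cases "{s \<in> S j. i \<le> s} = {}")
  case True
  then have "trop_val (S j) i = \<infinity>"
    unfolding trop_val_def True by (simp add: top_enat_def)
  then show ?thesis using True infinite by (simp add: trop_term_def)
next
  case False
  then obtain s0 where "s0 \<in> S j" "i \<le> s0" by auto
  then have "enat (s0 - i) \<in> (\<lambda>s. enat (s - i)) ` {s \<in> S j. i \<le> s}" by simp
  then have "trop_val (S j) i \<in> (\<lambda>s. enat (s - i)) ` {s \<in> S j. i \<le> s}"
    unfolding trop_val_def by (rule wellorder_InfI)
  then obtain s where s: "s \<in> S j" "i \<le> s" "trop_val (S j) i = enat (s - i)" by auto
  then have "trop_term (a i j) (S j) i = ereal (of_int (cost a i j s))"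
    by (simp add: trop_term_def cost_def of_nat_diff)
  then show ?thesis using s finite by blast
qed

lemma finite_indices: "finite {(i, j::'n::finite). i \<le> (k j :: nat)}"
proof -
  have "{(i, j). i \<le> k j} = (\<lambda>(j, i). (i, j)) ` (SIGMA j:UNIV. {..k j})" by auto
  then show ?thesis by simp
qed

lemma Sol_E:
  fixes k :: "'n::finite \<Rightarrow> nat"
  assumes "S \<in> Sol k a" "S \<noteq> bot"
  obtains i j s i' j' s' where "(i, j) \<noteq> (i', j')" "least_at k a S i j s i' j' s'"
proof -
  let ?t = "\<lambda>(i, j). trop_term (a i j) (S j) i"
  have "trop_vanishes {(i, j). i \<le> k j} ?t" using assms(1) by (simp add: Sol_def)
  then show thesis using finite_indices
  proof (cases rule: trop_vanishesE)
    case infinite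
    \<comment> \<open>The index \<open>0\<close> of a nonempty coordinate always carries a finite term.\<close>
    obtain j s where "s \<in> S j" using assms(2) by (auto simp: fun_eq_iff)
    then show thesis using trop_term_le[of s S j 0 a] infinite by simp
  next
    case (twice x y)
    obtain i j i' j' where xy: "x = (i, j)" "y = (i', j')" by (cases x, cases y)
    have k: "i \<le> k j" "i' \<le> k j'" using twice(1,2) xy by simp_all
    have eq: "?t (i, j) = ?t (i', j')" using twice(4) xy by simp
    have le: "?t (i, j) \<le> ?t (i'', j'')" if "i'' \<le> k j''" for i'' j''
      using twice(5) xy that by blast
    obtain j0 s0 where s0: "s0 \<in> S j0" using assms(2) by (auto simp: fun_eq_iff)
    have "?t (i, j) \<le> ereal (of_int (cost a 0 j0 s0))"
      using le[of 0 j0] trop_term_le[of s0 S j0 0 a] s0 by simp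
    then have lt: "?t (i, j) \<noteq> \<infinity>" by auto
    obtain s where s: "s \<in> S j" "i \<le> s" "?t (i, j) = ereal (of_int (cost a i j s))"
      using lt by (cases rule: trop_term_cases[of S j i a]) auto
    obtain s' where s': "s' \<in> S j'" "i' \<le> s'" "?t (i', j') = ereal (of_int (cost a i' j' s'))"
      using lt eq by (cases rule: trop_term_cases[of S j' i' a]) auto
    have "cost a i j s \<le> cost a i'' j'' s''" if "active k S i'' j'' s''" for i'' j'' s''
    proof -
      have "ereal (of_int (cost a i j s)) \<le> ?t (i'', j'')"
        using that le[of i'' j''] s(3) by (simp add: active_def)
      also have "\<dots> \<le> ereal (of_int (cost a i'' j'' s''))"
        using that trop_term_le[of s'' S j'' i'' a] by (simp add: active_def)
      finally show ?thesis by simp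
    qed
    then have "least_at k a S i j s i' j' s'"
      using k s s' eq by (simp add: least_at_def active_def)
    then show thesis using that twice(3) xy by blast
  qed
qed

lemma least_at_imp_Sol:
  fixes k :: "'n::finite \<Rightarrow> nat"
  assumes ne: "(i, j) \<noteq> (i', j')" and l: "least_at k a S i j s i' j' s'"
  shows "S \<in> Sol k a"
proof -
  let ?t = "\<lambda>(i, j). trop_term (a i j) (S j) i"
  have act: "active k S i j s" "active k S i' j' s'" "cost a i j s = cost a i' j' s'"
    using l by (simp_all add: least_at_def)
  have ge: "ereal (of_int (cost a i j s)) \<le> ?t (i'', j'')" if "i'' \<le> k j''" for i'' j''
  proof (cases rule: trop_term_cases[of S j'' i'' a])
    case (finite s'')
    then show ?thesis using least_at_le[OF l, of i'' j'' s''] that by (simp add: active_def)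
  qed simp
  have "?t (i, j) = ereal (of_int (cost a i j s))"
    using act(1) ge[of i j] trop_term_le[of s S j i a] by (simp add: active_def)
  moreover have "?t (i', j') = ereal (of_int (cost a i j s))"
    using act(2,3) ge[of i' j'] trop_term_le[of s' S j' i' a] by (simp add: active_def)
  ultimately have "trop_vanishes {(i, j). i \<le> k j} ?t"
    using act(1,2) ge ne
    by (intro trop_vanishes_twiceI[OF finite_indices, of "(i, j)" _ "(i', j')"])
      (auto simp only: active_def mem_Collect_eq prod.case)
  then show ?thesis by (simp add: Sol_def)
qed

section \<open>Tuples with one or two elements\<close>

lemma mono_t_apply: "mono_t j p j' = (if j' = j then {p} else {})"
  by (simp add: mono_t_def concentrated_def)

lemma mem_mono_t [simp]: "x \<in> mono_t j p j' \<longleftrightarrow> j' = j \<and> x = p"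
  by (simp add: mono_t_apply)

lemma mem_tuple_sum [simp]: "x \<in> (S \<oplus> T) j \<longleftrightarrow> x \<in> S j \<or> x \<in> T j"
  by (simp add: tuple_sum_def)

lemma tuple_eqI: "(\<And>j x. x \<in> S j \<longleftrightarrow> x \<in> T j) \<Longrightarrow> S = (T :: 'n \<Rightarrow> nat set)"
  by (auto simp: fun_eq_iff)

lemma tuple_leI: "(\<And>j x. x \<in> S j \<Longrightarrow> x \<in> T j) \<Longrightarrow> S \<le> (T :: 'n \<Rightarrow> nat set)"
  by (auto simp: le_fun_def)

lemma tuple_leD: "S \<le> T \<Longrightarrow> x \<in> S j \<Longrightarrow> x \<in> (T j :: nat set)"
  by (auto simp: le_fun_def)

lemma tuple_ne_bot: "x \<in> S j \<Longrightarrow> S \<noteq> (bot :: 'n \<Rightarrow> nat set)"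
  by auto

lemma tuple_sum_commute: "S \<oplus> T = T \<oplus> S"
  by (rule tuple_eqI) auto

lemma tuple_sum_self [simp]: "S \<oplus> S = S"
  by (rule tuple_eqI) auto

lemma mono_t_ne_bot: "mono_t j p \<noteq> bot"
  by (rule tuple_ne_bot[of p _ j]) simp

lemma mono_t_sum_ne_bot: "mono_t j p \<oplus> T \<noteq> bot"
  by (rule tuple_ne_bot[of p _ j]) simp

lemma mono_t_le_sum: "mono_t i p \<le> mono_t i p \<oplus> mono_t j q" "mono_t j q \<le> mono_t i p \<oplus> mono_t j q"
  by (auto intro: tuple_leI)

lemma active_mono_t [simp]: "active k (mono_t j p) i j' s \<longleftrightarrow> j' = j \<and> s = p \<and> i \<le> k j \<and> i \<le> p"
  by (auto simp: active_def)

lemma active_sum [simp]: "active k (S \<oplus> T) i j s \<longleftrightarrow> active k S i j s \<or> active k T i j s"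
  by (auto simp: active_def)

lemma enat_le_trop_ord_iff: "enat m \<le> trop_ord T \<longleftrightarrow> (\<forall>s\<in>T. m \<le> s)"
  by (auto simp: trop_ord_def le_INF_iff)

lemma trop_ord_less_iff: "trop_ord T < enat m \<longleftrightarrow> (\<exists>s\<in>T. s < m)"
  using enat_le_trop_ord_iff[of m T] by (auto simp: not_le[symmetric])

section \<open>Minimal solutions\<close>

lemma mu_SolD:
  assumes "S \<in> mu X" "S' \<in> X" "S' \<le> S" "S' \<noteq> bot"
  shows "S' = S"
  using assms by (auto simp: mu_def)

lemma mu_Sol_E:
  fixes k :: "'n::finite \<Rightarrow> nat"
  assumes "S \<in> mu (Sol k a)"
  obtains i j s i' j' s' where "(i, j) \<noteq> (i', j')" "least_at k a S i j s i' j' s'"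
    "S = mono_t j s \<oplus> mono_t j' s'"
proof -
  have "S \<in> Sol k a" "S \<noteq> bot" using assms by (simp_all add: mu_def)
  then obtain i j s i' j' s'
    where ne: "(i, j) \<noteq> (i', j')" and l: "least_at k a S i j s i' j' s'" by (rule Sol_E)
  let ?T = "mono_t j s \<oplus> mono_t j' s'"
  have act: "active k S i'' j'' s''" if "active k ?T i'' j'' s''" for i'' j'' s''
    using that l by (auto simp: least_at_def active_def)
  \<comment> \<open>The least cost of \<open>S\<close> is still realised at both indices, so \<open>?T\<close> is a solution below \<open>S\<close>.\<close>
  have "active k ?T i j s" "active k ?T i' j' s'"
    using l by (simp_all add: least_at_def active_def)
  then have "least_at k a ?T i j s i' j' s'"
    using l act unfolding least_at_def by blast
  then have "?T \<in> Sol k a" by (rule least_at_imp_Sol[OF ne])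
  moreover have "?T \<le> S" using l by (auto intro!: tuple_leI simp: least_at_def active_def)
  ultimately have "?T = S" by (rule mu_SolD[OF assms _ _ mono_t_sum_ne_bot])
  then show ?thesis using that[OF ne l] by simp
qed

lemma mono_t_in_mu_Sol_iff:
  fixes k :: "'n::finite \<Rightarrow> nat"
  shows "mono_t j s \<in> mu (Sol k a) \<longleftrightarrow> mono_t j s \<in> Sol k a"
proof -
  have "S = mono_t j s" if ne: "S \<noteq> bot" and le: "S \<le> mono_t j s" for S
  proof -
    have "\<And>j' x. x \<in> S j' \<Longrightarrow> j' = j \<and> x = s" using tuple_leD[OF le] by simp
    moreover obtain j' x where "x \<in> S j'" using ne by (auto simp: fun_eq_iff)
    ultimately show ?thesis by (intro tuple_eqI) (metis mem_mono_t)
  qed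
  then show ?thesis by (auto simp: mu_def mono_t_ne_bot)
qed

text \<open>The least cost of the tuple \<open>t_j^s\<close>; its single element is active at the indices up to \<open>s\<close> only.\<close>

definition least_cost :: "('n \<Rightarrow> nat) \<Rightarrow> (nat \<Rightarrow> 'n \<Rightarrow> int) \<Rightarrow> 'n \<Rightarrow> nat \<Rightarrow> int" where
  "least_cost k a j s = Min ((\<lambda>i. cost a i j s) ` {..min (k j) s})"

lemma least_cost_le: "i \<le> k j \<Longrightarrow> i \<le> s \<Longrightarrow> least_cost k a j s \<le> cost a i j s"
  unfolding least_cost_def by (intro Min_le) auto

lemma least_cost_attained:
  obtains i where "i \<le> k j" "i \<le> s" "least_cost k a j s = cost a i j s"
proof -
  have "least_cost k a j s \<in> (\<lambda>i. cost a i j s) ` {..min (k j) s}"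
    unfolding least_cost_def by (intro Min_in) auto
  then show ?thesis using that by auto
qed

lemma least_cost_eqI:
  assumes "i \<le> k j" "i \<le> s" "cost a i j s = c"
    and "\<And>x. x \<le> k j \<Longrightarrow> x \<le> s \<Longrightarrow> c \<le> cost a x j s"
  shows "least_cost k a j s = c"
proof (rule order_antisym)
  show "least_cost k a j s \<le> c" using least_cost_le[of i k j s a] assms(1-3) by simp
  obtain x where "x \<le> k j" "x \<le> s" "least_cost k a j s = cost a x j s"
    by (rule least_cost_attained)
  then show "c \<le> least_cost k a j s" using assms(4) by simp
qed

lemma least_cost_ge_order:
  assumes "k j \<le> s"
  shows "least_cost k a j s = Amin k a j + int s - int (k j)"
proof -
  let ?f = "\<lambda>i. a i j + int (k j) - int i"
  have "(\<lambda>i. cost a i j s) ` {..min (k j) s} = (\<lambda>x. x + (int s - int (k j))) ` ?f ` {..k j}"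
    using assms by (simp add: image_image cost_def min_absorb1 add_diff_eq)
  moreover have "Min ((\<lambda>x. x + (int s - int (k j))) ` ?f ` {..k j})
      = Min (?f ` {..k j}) + (int s - int (k j))"
    by (intro mono_Min_commute[symmetric]) (auto intro: monoI)
  ultimately show ?thesis by (simp add: least_cost_def Amin_def)
qed

lemma mono_t_in_Sol_iff_LP:
  fixes k :: "'n::finite \<Rightarrow> nat"
  assumes s: "k j \<le> s"
  shows "mono_t j s \<in> Sol k a \<longleftrightarrow> j \<in> LP k a"
proof
  assume "mono_t j s \<in> Sol k a"
  then obtain i m s1 i' m' s2 where ne: "(i, m) \<noteq> (i', m')"
    and la: "least_at k a (mono_t j s) i m s1 i' m' s2" by (rule Sol_E[OF _ mono_t_ne_bot])
  have eqs: "m = j" "s1 = s" "m' = j" "s2 = s" "i \<le> k j" "i' \<le> k j" "cost a i j s = cost a i' j s"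
    using la by (auto simp: least_at_def)
  have "i \<noteq> i'" using ne eqs by simp
  moreover have "a i j + int (k j) - int i = a i' j + int (k j) - int i'"
    using eqs(7) by (simp add: cost_def)
  moreover have "a i j + int (k j) - int i \<le> a x j + int (k j) - int x" if "x \<in> {..k j}" for x
    using least_at_le[OF la, of x j s] that s eqs by (simp add: cost_def)
  moreover have "i \<in> {..k j}" "i' \<in> {..k j}" using eqs by simp_all
  ultimately show "j \<in> LP k a"
    unfolding LP_def mem_Collect_eq by (intro attained_twiceI[of _ i i'] finite_atMost)
next
  assume "j \<in> LP k a"
  then obtain x y where "x \<le> k j" "y \<le> k j" and ne: "x \<noteq> y"
    and "cost a x j s = cost a y j s" "\<forall>z\<le>k j. cost a x j s \<le> cost a z j s"
    unfolding LP_def mem_Collect_eq cost_def by (rule attained_twiceE) simp_all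
  then have "least_at k a (mono_t j s) x j s y j s" using s by (simp add: least_at_def)
  then show "mono_t j s \<in> Sol k a" using ne by (intro least_at_imp_Sol) simp_all
qed

lemma le_pair_cases:
  assumes "T \<le> mono_t i p \<oplus> mono_t j q" "T \<noteq> bot"
  obtains "T = mono_t i p" | "T = mono_t j q" | "T = mono_t i p \<oplus> mono_t j q"
proof -
  have sub: "(m = i \<and> z = p) \<or> (m = j \<and> z = q)" if "z \<in> T m" for m z
    using tuple_leD[OF assms(1) that] by simp
  consider "p \<in> T i" "q \<in> T j" | "p \<notin> T i" "q \<in> T j" | "p \<in> T i" "q \<notin> T j"
    using assms(2) sub by (auto simp: fun_eq_iff)
  then show thesis
  proof cases
    case 1
    have "T = mono_t i p \<oplus> mono_t j q" using sub 1 by (intro tuple_eqI) auto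
    then show thesis by (rule that(3))
  next
    case 2
    have "T = mono_t j q" using sub 2 by (intro tuple_eqI) auto
    then show thesis by (rule that(2))
  next
    case 3
    have "T = mono_t i p" using sub 3 by (intro tuple_eqI) auto
    then show thesis by (rule that(1))
  qed
qed

lemma pair_in_mu_SolE:
  fixes k :: "'n::finite \<Rightarrow> nat"
  assumes "i \<noteq> j" and mu: "mono_t i p \<oplus> mono_t j q \<in> mu (Sol k a)" (is "?S \<in> _")
  obtains "mono_t i p \<notin> Sol k a" "mono_t j q \<notin> Sol k a" "least_cost k a i p = least_cost k a j q"
proof -
  have "p \<in> ?S i" "q \<in> ?S j" by simp_all
  then have "mono_t i p \<noteq> ?S" "mono_t j q \<noteq> ?S" using assms by (metis mem_mono_t)+
  then have ns: "mono_t i p \<notin> Sol k a" "mono_t j q \<notin> Sol k a"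
    using mu_SolD[OF mu _ mono_t_le_sum(1) mono_t_ne_bot]
      mu_SolD[OF mu _ mono_t_le_sum(2) mono_t_ne_bot] by auto
  obtain l m s l' m' s' where ne: "(l, m) \<noteq> (l', m')" and la: "least_at k a ?S l m s l' m' s'"
    and "?S = mono_t m s \<oplus> mono_t m' s'" by (rule mu_Sol_E[OF mu])
  have opt: "cost a l m s \<le> cost a x i p" if "x \<le> k i" "x \<le> p" for x
    using that by (intro least_at_le[OF la]) simp
  have opt': "cost a l m s \<le> cost a x j q" if "x \<le> k j" "x \<le> q" for x
    using that by (intro least_at_le[OF la]) simp
  \<comment> \<open>Two occurrences in the same coordinate would make a single summand a solution.\<close>
  have "\<not> (m = i \<and> m' = i)"
  proof
    assume "m = i \<and> m' = i"
    then have "least_at k a (mono_t i p) l m s l' m' s'"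
      using la assms by (auto simp: least_at_def)
    then show False using ns(1) least_at_imp_Sol[OF ne] by blast
  qed
  moreover have "\<not> (m = j \<and> m' = j)"
  proof
    assume "m = j \<and> m' = j"
    then have "least_at k a (mono_t j q) l m s l' m' s'"
      using la assms by (auto simp: least_at_def)
    then show False using ns(2) least_at_imp_Sol[OF ne] by blast
  qed
  ultimately obtain x y where x: "x \<le> k i" "x \<le> p" "cost a x i p = cost a l m s"
    and y: "y \<le> k j" "y \<le> q" "cost a y j q = cost a l m s"
    using la by (auto simp: least_at_def)
  have "least_cost k a i p = cost a l m s"
    using x opt by (rule least_cost_eqI)
  moreover have "least_cost k a j q = cost a l m s"
    using y opt' by (rule least_cost_eqI)
  ultimately show thesis using that ns by simp
qed

lemma pair_in_mu_SolI:
  fixes k :: "'n::finite \<Rightarrow> nat"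
  assumes "i \<noteq> j"
    and R: "mono_t i p \<notin> Sol k a" "mono_t j q \<notin> Sol k a" "least_cost k a i p = least_cost k a j q"
  shows "mono_t i p \<oplus> mono_t j q \<in> mu (Sol k a)" (is "?S \<in> _")
proof -
  obtain x where x: "x \<le> k i" "x \<le> p" "least_cost k a i p = cost a x i p"
    by (rule least_cost_attained)
  obtain y where y: "y \<le> k j" "y \<le> q" "least_cost k a j q = cost a y j q"
    by (rule least_cost_attained)
  have "cost a x i p \<le> cost a i'' j'' s''" if "active k ?S i'' j'' s''" for i'' j'' s''
    using that x(3) y(3) R least_cost_le[of i'' k i p a] least_cost_le[of i'' k j q a]
    by auto
  then have "least_at k a ?S x i p y j q"
    using x y R by (auto simp: least_at_def)
  then have sol: "?S \<in> Sol k a"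
    by (rule least_at_imp_Sol[rotated]) (use assms in simp)
  have "T = ?S" if T: "T \<in> Sol k a" "T \<noteq> bot" "T \<le> ?S" for T
    using T(3,2) by (cases rule: le_pair_cases) (use T(1) R in simp_all)
  then show ?thesis
    unfolding mu_def mem_Collect_eq by (intro conjI ballI impI sol mono_t_sum_ne_bot)
qed

lemma pair_in_mu_Sol_iff:
  fixes k :: "'n::finite \<Rightarrow> nat"
  assumes "i \<noteq> j"
  shows "mono_t i p \<oplus> mono_t j q \<in> mu (Sol k a) \<longleftrightarrow>
    mono_t i p \<notin> Sol k a \<and> mono_t j q \<notin> Sol k a \<and> least_cost k a i p = least_cost k a j q"
  using pair_in_mu_SolE[OF assms] pair_in_mu_SolI[OF assms] by metis

section \<open>Minimal solutions above the orders\<close>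

lemma mem_CZ_iff: "S \<in> CZ k a \<longleftrightarrow> S \<in> mu (Sol k a) \<and> (\<forall>j. \<forall>s\<in>S j. k j \<le> s)"
  by (simp add: CZ_def enat_le_trop_ord_iff)

lemma pair_in_CZ_iff:
  fixes k :: "'n::finite \<Rightarrow> nat"
  assumes "b \<noteq> c" "k b \<le> p" "k c \<le> q"
  shows "mono_t b p \<oplus> mono_t c q \<in> CZ k a \<longleftrightarrow> b \<notin> LP k a \<and> c \<notin> LP k a \<and>
    Amin k a b + int p - int (k b) = Amin k a c + int q - int (k c)"
  using assms
  by (auto simp: mem_CZ_iff pair_in_mu_Sol_iff mono_t_in_Sol_iff_LP least_cost_ge_order)

lemma CZ_cases:
  fixes k :: "'n::finite \<Rightarrow> nat"
  assumes "S \<in> CZ k a"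
  obtains (single) j r where "j \<in> LP k a" "S = mono_t j (k j + r)"
  | (pair) b c r where "b \<notin> LP k a" "c \<notin> LP k a" "b \<noteq> c" "Amin k a c \<le> Amin k a b"
      "S = mono_t b (k b + r) \<oplus> mono_t c (k c + nat (Amin k a b - Amin k a c) + r)"
proof -
  have pair_case: thesis if S: "S = mono_t b p \<oplus> mono_t c q" "b \<noteq> c" "k b \<le> p" "k c \<le> q"
    and A: "Amin k a c \<le> Amin k a b" for b c p q
  proof -
    have *: "b \<notin> LP k a" "c \<notin> LP k a"
        "Amin k a b + int p - int (k b) = Amin k a c + int q - int (k c)"
      using pair_in_CZ_iff[of b c k p q a] assms S by auto
    have p: "p = k b + (p - k b)" using S(3) by simp
    have "q = k c + nat (Amin k a b - Amin k a c) + (p - k b)"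
      using *(3) A S(3,4) by simp
    then show thesis using pair[of b c "p - k b"] * A S(1,2) p by metis
  qed
  have mu: "S \<in> mu (Sol k a)" and ord: "\<And>j s. s \<in> S j \<Longrightarrow> k j \<le> s"
    using assms by (auto simp: mem_CZ_iff)
  from mu obtain i j s i' j' s' where ne: "(i, j) \<noteq> (i', j')"
    and la: "least_at k a S i j s i' j' s'" and S: "S = mono_t j s \<oplus> mono_t j' s'"
    by (rule mu_Sol_E)
  have s: "k j \<le> s" and s': "k j' \<le> s'" using ord[of s j] ord[of s' j'] S by auto
  show thesis
  proof (cases "j = j'")
    case True
    \<comment> \<open>Above the order every index may use either element, so the least cost forces \<open>s = s'\<close>.\<close>
    have "active k S i j s'" "active k S i' j s"
      using la True s s' by (auto simp: least_at_def active_def)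
    then have "cost a i j s \<le> cost a i j s'" "cost a i j s \<le> cost a i' j s"
      by (blast intro: least_at_le[OF la])+
    moreover have "cost a i j s = cost a i' j s'" using la True by (simp add: least_at_def)
    ultimately have "s = s'" by (simp add: cost_def)
    then have "S = mono_t j s" using S True by simp
    then show thesis
      using single[of j "s - k j"] mu s mono_t_in_Sol_iff_LP[of k j s a]
      by (simp add: mu_def)
  next
    case False
    show thesis
    proof (cases "Amin k a j' \<le> Amin k a j")
      case True
      then show thesis using pair_case[OF S False s s'] by blast
    next
      case False
      then show thesis
        using pair_case[of j' s' j s] S \<open>j \<noteq> j'\<close> s s' tuple_sum_commute[of "mono_t j s"] by simp
    qed
  qed
qed

lemma CZ_eq:
  fixes k :: "'n::finite \<Rightarrow> nat"
  shows "CZ k a =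
       (\<Union>j\<in>LP k a. {mono_t j (k j + r) | r. True}) \<union>
       (\<Union>(b, c)\<in>{(b, c). b \<notin> LP k a \<and> c \<notin> LP k a \<and> b \<noteq> c \<and> Amin k a c \<le> Amin k a b}.
          {mono_t b (k b + r) \<oplus> mono_t c (k c + nat (Amin k a b - Amin k a c) + r) | r. True})"
    (is "_ = ?U \<union> ?V")
proof (rule set_eqI, rule iffI)
  fix S assume "S \<in> CZ k a"
  then show "S \<in> ?U \<union> ?V"
    by (cases rule: CZ_cases) blast+
next
  fix S assume "S \<in> ?U \<union> ?V"
  then consider j r where "j \<in> LP k a" "S = mono_t j (k j + r)"
    | b c r where "b \<notin> LP k a" "c \<notin> LP k a" "b \<noteq> c" "Amin k a c \<le> Amin k a b"
      "S = mono_t b (k b + r) \<oplus> mono_t c (k c + nat (Amin k a b - Amin k a c) + r)"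
    by blast
  then show "S \<in> CZ k a"
  proof cases
    case 1
    then show ?thesis by (auto simp: mem_CZ_iff mono_t_in_mu_Sol_iff mono_t_in_Sol_iff_LP)
  next
    case 2
    then show ?thesis by (simp add: pair_in_CZ_iff)
  qed
qed

section \<open>The remaining minimal solutions\<close>

lemma mem_FP_iff: "S \<in> FP k a \<longleftrightarrow> S \<in> mu (Sol k a) \<and> (\<exists>j. \<exists>s\<in>S j. s < k j)"
  by (auto simp: FP_def mem_CZ_iff not_le)

lemma least_at_swap: "least_at k a S i j s i' j' s' \<Longrightarrow> least_at k a S i' j' s' i j s"
  unfolding least_at_def by metis

text \<open>By symmetry, the element that lies below the order of its coordinate may be listed first.\<close>

lemma FP_E:
  fixes k :: "'n::finite \<Rightarrow> nat"
  assumes "S \<in> FP k a"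
  obtains i j s i' j' s' where "least_at k a S i j s i' j' s'" "S = mono_t j s \<oplus> mono_t j' s'"
    "s < k j"
proof -
  have mu: "S \<in> mu (Sol k a)" and ex: "\<exists>j. \<exists>s\<in>S j. s < k j"
    using assms by (simp_all add: mem_FP_iff)
  from mu obtain i j s i' j' s' where la: "least_at k a S i j s i' j' s'"
    and S: "S = mono_t j s \<oplus> mono_t j' s'" by (rule mu_Sol_E)
  from ex S consider "s < k j" | "s' < k j'" by auto
  then show thesis
  proof cases
    case 1
    then show thesis by (rule that[OF la S])
  next
    case 2
    have "S = mono_t j' s' \<oplus> mono_t j s" using S by (simp only: tuple_sum_commute)
    then show thesis using 2 by (rule that[OF least_at_swap[OF la]])
  qed
qed

lemma finite_FP:
  fixes k :: "'n::finite \<Rightarrow> nat"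
  shows "finite (FP k a)"
proof -
  let ?I = "{(i, j). i \<le> k j}"
  \<comment> \<open>Equality of costs at \<open>(i, j)\<close> and \<open>(i', j')\<close> determines the second element from \<open>s\<close>. The bound
      \<open>s < k j\<close> is expressed by letting \<open>(s, j)\<close> range over the finite set \<open>?I\<close> as well.\<close>
  let ?f = "\<lambda>((i, j), (s, _::'n), (i', j')).
    mono_t j s \<oplus> mono_t j' (nat (cost a i j s - a i' j' + int i'))"
  have "FP k a \<subseteq> ?f ` (?I \<times> ?I \<times> ?I)"
  proof
    fix S assume "S \<in> FP k a"
    then obtain i j s i' j' s' where la: "least_at k a S i j s i' j' s'"
      and S: "S = mono_t j s \<oplus> mono_t j' s'" and "s < k j" by (rule FP_E)
    have "s' = nat (cost a i j s - a i' j' + int i')"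
      using la by (simp add: least_at_def cost_def[of a i' j'])
    then have "S = ?f ((i, j), (s, j), (i', j'))" using S by simp
    moreover have "((i, j), (s, j), (i', j')) \<in> ?I \<times> ?I \<times> ?I"
      using la \<open>s < k j\<close> by (simp add: least_at_def active_def)
    ultimately show "S \<in> ?f ` (?I \<times> ?I \<times> ?I)" by (rule image_eqI)
  qed
  moreover have "finite (?f ` (?I \<times> ?I \<times> ?I))"
    by (intro finite_imageI finite_cartesian_product finite_indices)
  ultimately show ?thesis by (rule finite_subset)
qed

lemma concentrated_in_Sol_iff:
  fixes k :: "'n::finite \<Rightarrow> nat"
  shows "concentrated j T \<in> Sol k a \<longleftrightarrow> T \<in> Sol1 (k j) (\<lambda>i. a i j)"
proof -
  let ?I = "{(i, j). i \<le> k j}" and ?J = "(\<lambda>i. (i, j)) ` {..k j}"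
  let ?t = "\<lambda>(i, j'). trop_term (a i j') (concentrated j T j') i"
  have "?t z = \<infinity>" if "z \<in> ?I" "z \<notin> ?J" for z
  proof -
    obtain i j' where z: "z = (i, j')" by (cases z)
    then have "j' \<noteq> j" using that by auto
    then show ?thesis
      using z by (simp add: concentrated_def trop_term_def trop_val_def top_enat_def)
  qed
  then have "trop_vanishes ?I ?t \<longleftrightarrow> trop_vanishes ?J ?t"
    by (intro trop_vanishes_subset_iff[OF finite_indices]) auto
  also have "\<dots> \<longleftrightarrow> trop_vanishes {..k j} (\<lambda>i. trop_term (a i j) T i)"
    by (subst trop_vanishes_reindex) (simp_all add: inj_on_def concentrated_def)
  finally show ?thesis by (simp add: Sol_def Sol1_def)
qed

lemma concentrated_le_iff: "concentrated j T \<le> concentrated j T' \<longleftrightarrow> T \<subseteq> T'"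
  by (auto simp: concentrated_def le_fun_def)

lemma concentrated_eq_bot_iff: "concentrated j T = bot \<longleftrightarrow> T = bot"
  by (auto simp: concentrated_def fun_eq_iff)

lemma concentrated_eq_iff: "concentrated j T = concentrated j T' \<longleftrightarrow> T = T'"
  by (auto simp: concentrated_def fun_eq_iff)

lemma le_concentrated: "S \<le> concentrated j T \<Longrightarrow> S = concentrated j (S j)"
  by (auto simp: concentrated_def fun_eq_iff le_fun_def split: if_splits)

lemma concentrated_in_mu_Sol_iff:
  fixes k :: "'n::finite \<Rightarrow> nat"
  shows "concentrated j T \<in> mu (Sol k a) \<longleftrightarrow> T \<in> mu (Sol1 (k j) (\<lambda>i. a i j))"
proof -
  have "(\<forall>S\<in>Sol k a. S \<noteq> bot \<longrightarrow> S \<le> concentrated j T \<longrightarrow> S = concentrated j T) \<longleftrightarrow>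
      (\<forall>T'\<in>Sol1 (k j) (\<lambda>i. a i j). T' \<noteq> bot \<longrightarrow> T' \<le> T \<longrightarrow> T' = T)" (is "?A \<longleftrightarrow> ?B")
  proof
    assume A: ?A
    show ?B
    proof (intro ballI impI)
      fix T' assume "T' \<in> Sol1 (k j) (\<lambda>i. a i j)" "T' \<noteq> bot" "T' \<le> T"
      then have "concentrated j T' = concentrated j T"
        using A by (simp add: concentrated_in_Sol_iff concentrated_eq_bot_iff concentrated_le_iff)
      then show "T' = T" by (simp add: concentrated_eq_iff)
    qed
  next
    assume B: ?B
    show ?A
    proof (intro ballI impI)
      fix S assume h: "S \<in> Sol k a" "S \<noteq> bot" "S \<le> concentrated j T"
      obtain T' where S: "S = concentrated j T'" using le_concentrated[OF h(3)] by blast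
      have "T' = T"
        using B h unfolding S concentrated_in_Sol_iff concentrated_eq_bot_iff concentrated_le_iff
        by blast
      then show "S = concentrated j T" using S by simp
    qed
  qed
  then show ?thesis
    by (simp add: mu_def concentrated_in_Sol_iff concentrated_eq_bot_iff)
qed

lemma concentrated_in_FP_iff:
  fixes k :: "'n::finite \<Rightarrow> nat"
  shows "concentrated j T \<in> FP k a \<longleftrightarrow> T \<in> FP1 (k j) (\<lambda>i. a i j)"
  unfolding mem_FP_iff FP1_def mem_Collect_eq concentrated_in_mu_Sol_iff trop_ord_less_iff
  by (auto simp: concentrated_def split: if_splits)

lemma Supp_eq_singleton_iff:
  fixes k :: "'n::finite \<Rightarrow> nat"
  assumes "S \<in> FP k a"
  shows "Supp S = {j} \<longleftrightarrow> S \<in> concentrated j ` FP1 (k j) (\<lambda>i. a i j)"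
proof
  assume "Supp S = {j}"
  then have "S = concentrated j (S j)"
    by (auto simp: Supp_def concentrated_def fun_eq_iff)
  then show "S \<in> concentrated j ` FP1 (k j) (\<lambda>i. a i j)"
    using assms concentrated_in_FP_iff by (metis image_eqI)
next
  assume "S \<in> concentrated j ` FP1 (k j) (\<lambda>i. a i j)"
  then obtain T where "S = concentrated j T" "T \<noteq> {}"
    by (auto simp: FP1_def mu_def)
  then show "Supp S = {j}"
    by (auto simp: Supp_def concentrated_def)
qed

lemma FP_pair_high:
  fixes k :: "'n::finite \<Rightarrow> nat"
  assumes "i \<noteq> j" "k j \<le> q" "mono_t i p \<oplus> mono_t j q \<in> FP k a"
  shows "j \<notin> LP k a"
    and "k j \<le> q' \<Longrightarrow> mono_t i p \<oplus> mono_t j q' \<in> FP k a \<Longrightarrow> q' = q"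
proof -
  have *: "j \<notin> LP k a \<and> least_cost k a i p = Amin k a j + int q - int (k j)"
    if "k j \<le> q" "mono_t i p \<oplus> mono_t j q \<in> FP k a" for q
    using that assms(1)
    by (auto simp: mem_FP_iff pair_in_mu_Sol_iff mono_t_in_Sol_iff_LP least_cost_ge_order)
  show "j \<notin> LP k a" using *[OF assms(2,3)] by blast
  show "q' = q" if "k j \<le> q'" "mono_t i p \<oplus> mono_t j q' \<in> FP k a"
    using *[OF assms(2,3)] *[OF that] by simp
qed

lemma FP_cases:
  fixes k :: "'n::finite \<Rightarrow> nat"
  assumes "S \<in> FP k a"
  obtains (single) j where "Supp S = {j}"
  | (low) i j p q where "i \<noteq> j" "Supp S = {i, j}" "S = mono_t i p \<oplus> mono_t j q" "p < k i" "q < k j"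
  | (high) i j p q where "i \<noteq> j" "Supp S = {i, j}" "S = mono_t i p \<oplus> mono_t j q"
      "p < k i" "j \<notin> LP k a" "k j \<le> q"
      "\<forall>q'. k j \<le> q' \<and> mono_t i p \<oplus> mono_t j q' \<in> FP k a \<longrightarrow> q' = q"
proof -
  from assms obtain i p j q where S: "S = mono_t i p \<oplus> mono_t j q" and p: "p < k i"
    by (rule FP_E)
  have Supp: "Supp S = {i, j}" using S by (auto simp: Supp_def)
  show thesis
  proof (cases "i = j")
    case True
    then show thesis using single[of j] Supp by simp
  next
    case ij: False
    show thesis
    proof (cases "q < k j")
      case True
      then show thesis by (rule low[OF ij Supp S p])
    next
      case False
      then have q: "k j \<le> q" by simp
      have FP: "mono_t i p \<oplus> mono_t j q \<in> FP k a" using assms S by simp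
      note high_q = FP_pair_high[OF ij q FP]
      show thesis by (rule high[OF ij Supp S p high_q(1) q]) (use high_q(2) in blast)
    qed
  qed
qed

lemma FP_pair_cases:
  fixes k :: "'n::finite \<Rightarrow> nat"
  assumes "S \<in> FP k a"
  shows "(\<exists>j. Supp S = {j}) \<or>
        (\<exists>i j p q. i \<noteq> j \<and> Supp S = {i, j} \<and> S = mono_t i p \<oplus> mono_t j q \<and>
          (p < k i \<and> q < k j \<or>
           p < k i \<and> j \<notin> LP k a \<and> k j \<le> q \<and>
             (\<forall>q'. k j \<le> q' \<and> mono_t i p \<oplus> mono_t j q' \<in> FP k a \<longrightarrow> q' = q) \<or>
           q < k j \<and> i \<notin> LP k a \<and> k i \<le> p \<and>
             (\<forall>p'. k i \<le> p' \<and> mono_t i p' \<oplus> mono_t j q \<in> FP k a \<longrightarrow> p' = p)))"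
  using assms
proof (cases rule: FP_cases)
  case single
  then show ?thesis by blast
next
  case low
  then show ?thesis by blast
next
  case high
  then show ?thesis by blast
qed

theorem theorem3p26:
  fixes k :: "'n::finite \<Rightarrow> nat" and a :: "nat \<Rightarrow> 'n \<Rightarrow> int"
  assumes "CARD('n) > 1" and "\<And>j. k j > 0"
  shows
    "(CZ k a =
       (\<Union>j\<in>LP k a. {mono_t j (k j + r) | r. True}) \<union>
       (\<Union>(b, c)\<in>{(b, c). b \<notin> LP k a \<and> c \<notin> LP k a \<and> b \<noteq> c \<and> Amin k a c \<le> Amin k a b}.
          {mono_t b (k b + r) \<oplus> mono_t c (k c + nat (Amin k a b - Amin k a c) + r) | r. True})) \<and>
     finite (FP k a) \<and>
     (\<forall>S \<in> FP k a.
       (\<forall>j. Supp S = {j} \<longleftrightarrow> S \<in> concentrated j ` FP1 (k j) (\<lambda>i. a i j)) \<and>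
       ((\<exists>j. Supp S = {j}) \<or>
        (\<exists>i j p q. i \<noteq> j \<and> Supp S = {i, j} \<and> S = mono_t i p \<oplus> mono_t j q \<and>
          (p < k i \<and> q < k j \<or>
           p < k i \<and> j \<notin> LP k a \<and> k j \<le> q \<and>
             (\<forall>q'. k j \<le> q' \<and> mono_t i p \<oplus> mono_t j q' \<in> FP k a \<longrightarrow> q' = q) \<or>
           q < k j \<and> i \<notin> LP k a \<and> k i \<le> p \<and>
             (\<forall>p'. k i \<le> p' \<and> mono_t i p' \<oplus> mono_t j q \<in> FP k a \<longrightarrow> p' = p)))))"
  by (intro conjI ballI allI CZ_eq finite_FP Supp_eq_singleton_iff FP_pair_cases)

end
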